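(* For every connected (finite, simple) graph $G$ with at least one vertex there is a tree $T$ rooted at a vertex $r$ and a partition $\mathcal{P}$ of $V(G)$ into non-empty sets, together with a bijection $x\mapsto P_x$ from $V(T)$ to $\mathcal{P}$, such that: (i) each $G[P_x]$ is connected; (ii) for distinct $x,y\in V(T)$, there is an edge of $G$ between $P_x$ and $P_y$ if and only if one of $x,y$ is an ancestor of the other in $T$; (iii) for every $x\in V(T)$ there is an independent set $I$ of $G$ with $I\subseteq P_x$ and $|P_x|=2|I|-1$; (iv) for every leaf $v$ of $T$, if $r=x_1,x_2,\dots,x_k=v$ is the path in $T$ from $r$ to $v$, then $(G[P_{x_1}],G[P_{x_2}],\dots,G[P_{x_k}])$ is a dominating $K_k$-model in $G$.
   Context: A dominating $K_t$-model in a graph $G$ is a sequence $(T_1,\dots,T_t)$ of pairwise disjoint non-empty connected subgraphs of $G$ such that for all $1\le i<j\le t$, every vertex of $T_j$ has a neighbour in $T_i$. (Conditions (i)–(ii) say that $\mathcal{P}$ is a connected partition of $G$ whose quotient graph is the closure $\widehat{T}$ of $T$, i.e. the graph on $V(T)$ where two vertices are adjacent iff one is an ancestor of the other.) *)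

theory Defs
  imports "HOL-Library.Disjoint_Sets" "Graph_Theory.Graph_Theory"
begin

text \<open>
  Finite simple graphs are rendered by the locale predicate \<^const>\<open>graph\<close>: finite, symmetric
  digraphs without loops and parallel arcs, where an undirected edge is a pair of opposite arcs.
  Hence \<open>u \<rightarrow>\<^bsub>G\<^esub> v\<close> is adjacency and \<open>G \<restriction> S\<close> is the induced subgraph on \<open>S\<close>.
\<close>

definition independent_set :: "('a, 'b) pre_digraph \<Rightarrow> 'a set \<Rightarrow> bool" where
  "independent_set G I \<longleftrightarrow> I \<subseteq> verts G \<and> (\<forall>u \<in> I. \<forall>v \<in> I. \<not> u \<rightarrow>\<^bsub>G\<^esub> v)"

text \<open>
  The library's \<^const>\<open>tree\<close> is of no use for symmetric digraphs, because an arc followed by its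
  opposite is a directed cycle of length 2. The cycles of the underlying undirected graph
  are exactly the directed cycles of length at least 3.
\<close>

definition undirected_tree :: "('a, 'b) pre_digraph \<Rightarrow> bool" where
  "undirected_tree T \<longleftrightarrow>
     graph T \<and> Digraph_Component.connected T \<and> \<not> (\<exists>p. pre_digraph.cycle T p \<and> length p \<ge> 3)"

definition rooted_tree :: "('a, 'b) pre_digraph \<Rightarrow> 'a \<Rightarrow> bool" where
  "rooted_tree T r \<longleftrightarrow> undirected_tree T \<and> r \<in> verts T"

text \<open>The ancestor relation is reflexive here.\<close>

definition ancestor :: "('a, 'b) pre_digraph \<Rightarrow> 'a \<Rightarrow> 'a \<Rightarrow> 'a \<Rightarrow> bool" where
  "ancestor T r x y \<longleftrightarrow>
     (\<exists>p. pre_digraph.apath T r p y \<and> x \<in> set (pre_digraph.awalk_verts T r p))"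

text \<open>
  A leaf of a rooted tree is a vertex without children. In particular the root is a leaf only
  if it is the only vertex.
\<close>

definition leaf :: "('a, 'b) pre_digraph \<Rightarrow> 'a \<Rightarrow> 'a \<Rightarrow> bool" where
  "leaf T r v \<longleftrightarrow> v \<in> verts T \<and> \<not> (\<exists>w. v \<rightarrow>\<^bsub>T\<^esub> w \<and> ancestor T r v w)"

text \<open>
  The subgraphs of the sequence are indexed from 0. \<^const>\<open>subgraph\<close> alone does not make
  \<open>Ts ! i\<close> undirected, therefore \<^const>\<open>graph\<close> is required as well.
\<close>

definition dominating_K_model ::
  "('a, 'b) pre_digraph \<Rightarrow> nat \<Rightarrow> ('a, 'b) pre_digraph list \<Rightarrow> bool" where
  "dominating_K_model G t Ts \<longleftrightarrow>
     length Ts = t \<and>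
     (\<forall>i < t. graph (Ts ! i) \<and> subgraph (Ts ! i) G \<and> verts (Ts ! i) \<noteq> {} \<and>
        Digraph_Component.connected (Ts ! i)) \<and>
     (\<forall>i j. i < j \<and> j < t \<longrightarrow> verts (Ts ! i) \<inter> verts (Ts ! j) = {}) \<and>
     (\<forall>i j. i < j \<and> j < t \<longrightarrow> (\<forall>v \<in> verts (Ts ! j). \<exists>u \<in> verts (Ts ! i). v \<rightarrow>\<^bsub>G\<^esub> u))"

end

theory Submission
  imports Defs
begin

text \<open>
  Duchet and Meyniel: let \<open>D \<subseteq> S\<close> be inclusion-maximal among the connected sets of size \<open>2|I| - 1\<close>
  with \<open>I \<subseteq> D\<close> independent. No vertex \<open>v\<close> of \<open>S\<close> is at distance 2 from \<open>D\<close> in \<open>G[S]\<close>, since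
  otherwise \<open>D\<close> could be extended by \<open>v\<close> and a common neighbour of \<open>v\<close> and \<open>D\<close>, and \<open>I\<close> by \<open>v\<close>.
  Hence \<open>D\<close> together with its neighbours in \<open>S\<close> is a component of \<open>G[S]\<close>, dominated by \<open>D\<close>.
  Taking \<open>D\<close> as the root bag of this component and recursing into its neighbours and into the
  rest of \<open>S\<close> gives the forest.
\<close>

section \<open>Connected sets of size twice the size of an independent subset minus one\<close>

text \<open>Reachability is symmetric in a symmetric digraph, so any two vertices are joined through
  \<open>r\<close>. The choice of \<open>r\<close> also carries the non-emptiness that connectedness
  includes.\<close>

lemma (in sym_digraph) connected_iff_reachable_from:
  "Digraph_Component.connected G \<longleftrightarrow> (\<exists>r \<in> verts G. \<forall>v \<in> verts G. r \<rightarrow>\<^sup>*\<^bsub>G\<^esub> v)"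
proof
  assume "Digraph_Component.connected G"
  then have "strongly_connected G"
    using sym_arcs by (rule symmetric_connected_imp_strongly_connected[rotated])
  then show "\<exists>r \<in> verts G. \<forall>v \<in> verts G. r \<rightarrow>\<^sup>*\<^bsub>G\<^esub> v"
    by (auto simp: strongly_connected_def)
next
  assume "\<exists>r \<in> verts G. \<forall>v \<in> verts G. r \<rightarrow>\<^sup>*\<^bsub>G\<^esub> v"
  then obtain r where r: "r \<in> verts G" "\<And>v. v \<in> verts G \<Longrightarrow> r \<rightarrow>\<^sup>*\<^bsub>G\<^esub> v"
    by blast
  show "Digraph_Component.connected G"
  proof (rule connectedI)
    fix u v
    assume "u \<in> verts G" "v \<in> verts G"
    then have "u \<rightarrow>\<^sup>*\<^bsub>G\<^esub> v"
      using r reachable_trans symmetric_reachable' by blast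
    then show "u \<rightarrow>\<^sup>*\<^bsub>mk_symmetric G\<^esub> v"
      by (rule reachable_mk_symmetricI)
  qed (use r in auto)
qed

lemma (in sym_digraph) sym_digraph_induce: "S \<subseteq> verts G \<Longrightarrow> sym_digraph (G \<restriction> S)"
  by (intro induced_graph_imp_graph induced_induce)

lemma (in graph) graph_induce:
  assumes "S \<subseteq> verts G" shows "graph (G \<restriction> S)"
proof -
  interpret D: digraph "G \<restriction> S"
    using assms by (blast intro: digraphI_induced)
  show ?thesis
    using sym_digraph_induce[OF assms] by (intro D.graphI sym_digraph.sym_arcs)
qed

text \<open>Walks inside \<open>D\<close> survive in the larger induced subgraph, and
  \<open>w\<close> is one arc beyond \<open>d\<close>.\<close>

lemma (in sym_digraph) connected_induce_insert:
  assumes "D \<subseteq> verts G" and "Digraph_Component.connected (G \<restriction> D)"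
    and "d \<in> D" and "d \<rightarrow>\<^bsub>G\<^esub> w"
  shows "Digraph_Component.connected (G \<restriction> insert w D)"
proof -
  have w: "insert w D \<subseteq> verts G"
    using assms adj_in_verts by blast
  interpret D: sym_digraph "G \<restriction> D"
    by (rule sym_digraph_induce[OF assms(1)])
  interpret W: sym_digraph "G \<restriction> insert w D"
    by (rule sym_digraph_induce[OF w])
  obtain r where r: "r \<in> D" "\<And>v. v \<in> D \<Longrightarrow> r \<rightarrow>\<^sup>*\<^bsub>G \<restriction> D\<^esub> v"
    using assms(2) by (auto simp: D.connected_iff_reachable_from)
  have reach: "r \<rightarrow>\<^sup>*\<^bsub>G \<restriction> insert w D\<^esub> v" if "v \<in> D" for v
    using r(2)[OF that] by (rule reachable_induce_ss) blast
  have "d \<rightarrow>\<^bsub>G \<restriction> insert w D\<^esub> w"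
    using assms(3,4) by (auto simp: arcs_ends_conv)
  then have "r \<rightarrow>\<^sup>*\<^bsub>G \<restriction> insert w D\<^esub> w"
    using reach[OF assms(3)] W.reachable_adj_trans by blast
  with reach r(1) show ?thesis
    by (auto simp: W.connected_iff_reachable_from)
qed

section \<open>Bags, their extension and maximal bags\<close>

text \<open>The size condition is \<open>|D| = 2|I| - 1\<close> with the subtraction moved to the
  other side, since truncated subtraction would admit an empty \<open>D\<close>.\<close>

definition bag :: "('a, 'b) pre_digraph \<Rightarrow> 'a set \<Rightarrow> bool" where
  "bag G D \<longleftrightarrow> D \<subseteq> verts G \<and> Digraph_Component.connected (G \<restriction> D) \<and>
     (\<exists>I. independent_set G I \<and> I \<subseteq> D \<and> card D + 1 = 2 * card I)"

lemma (in graph) bag_singleton: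
  assumes "u \<in> verts G" shows "bag G {u}"
proof -
  interpret U: sym_digraph "G \<restriction> {u}"
    using assms by (intro sym_digraph_induce) simp
  have "Digraph_Component.connected (G \<restriction> {u})"
    by (simp add: U.connected_iff_reachable_from)
  moreover have "independent_set G {u}"
    using assms adj_not_same by (auto simp: independent_set_def)
  ultimately show ?thesis
    using assms unfolding bag_def by (intro conjI exI[of _ "{u}"]) auto
qed

text \<open>The set grows by two vertices and its independent set by one, which preserves the size
  condition. The vertex \<open>w\<close> keeps the set connected; \<open>v\<close> joins the
  independent set because it has no neighbour in \<open>D\<close>.\<close>

lemma (in graph) bag_extend:
  assumes "bag G D" and "d \<in> D" and "d \<rightarrow>\<^bsub>G\<^esub> w" and "w \<rightarrow>\<^bsub>G\<^esub> v"
    and "w \<notin> D" and "v \<notin> D" and far: "\<And>x. x \<in> D \<Longrightarrow> \<not> x \<rightarrow>\<^bsub>G\<^esub> v"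
  shows "bag G (insert v (insert w D))"
proof -
  obtain I where D: "D \<subseteq> verts G" "Digraph_Component.connected (G \<restriction> D)"
    and I: "independent_set G I" "I \<subseteq> D" "card D + 1 = 2 * card I"
    using assms(1) unfolding bag_def by blast
  have verts: "w \<in> verts G" "v \<in> verts G"
    using assms adj_in_verts by blast+
  have "Digraph_Component.connected (G \<restriction> insert w D)"
    by (rule connected_induce_insert[OF D assms(2,3)])
  then have "Digraph_Component.connected (G \<restriction> insert v (insert w D))"
    using D(1) verts assms(4) by (intro connected_induce_insert[of "insert w D" w]) auto
  moreover have "independent_set G (insert v I)"
    using I(1,2) verts far graph_symmetric adj_not_same
    unfolding independent_set_def by blast
  moreover have "card (insert v (insert w D)) + 1 = 2 * card (insert v I)"
  proof -
    have "finite D"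
      using D(1) finite_verts finite_subset by blast
    moreover have "finite I"
      using \<open>finite D\<close> I(2) finite_subset by blast
    moreover have "v \<noteq> w" "v \<notin> I"
      using assms adj_not_same I(2) by blast+
    ultimately show ?thesis
      using I(3) assms(5,6) by simp
  qed
  ultimately show ?thesis
    using D(1) verts I(2) unfolding bag_def by blast
qed

text \<open>Written as a binary relation on sets so that \<open>sorted_wrt\<close> can express
  domination for all pairs of a list of bags.\<close>

definition dominates_set :: "('a, 'b) pre_digraph \<Rightarrow> 'a set \<Rightarrow> 'a set \<Rightarrow> bool" where
  "dominates_set G A B \<longleftrightarrow> (\<forall>v \<in> B. \<exists>u \<in> A. v \<rightarrow>\<^bsub>G\<^esub> u)"

text \<open>\<open>D\<close> is a maximal bag within \<open>S\<close> among those containing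
  \<open>r\<close>, and \<open>B\<close> consists of all neighbours of \<open>D\<close> in
  \<open>S - D\<close>. The family of such bags is finite, and \<open>{r}\<close> belongs to
  it.\<close>

lemma (in graph) dominating_bag_exists:
  assumes "S \<subseteq> verts G" and "r \<in> S"
  obtains D B where "bag G D" and "r \<in> D" and "D \<inter> B = {}" and "D \<union> B \<subseteq> S"
    and "dominates_set G D B"
    and "\<And>u v. u \<in> D \<union> B \<Longrightarrow> v \<in> S - (D \<union> B) \<Longrightarrow> \<not> u \<rightarrow>\<^bsub>G\<^esub> v"
proof -
  let ?\<D> = "{D. bag G D \<and> r \<in> D \<and> D \<subseteq> S}"
  have "finite S"
    using assms(1) finite_verts finite_subset by blast
  then have "finite ?\<D>"
    by simp
  moreover have "{r} \<in> ?\<D>"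
    using assms bag_singleton by auto
  ultimately have "\<exists>D \<in> ?\<D>. {r} \<subseteq> D \<and> (\<forall>D' \<in> ?\<D>. D \<subseteq> D' \<longrightarrow> D = D')"
    by (rule finite_has_maximal2)
  then obtain D where D: "D \<in> ?\<D>" and max: "\<And>D'. D' \<in> ?\<D> \<Longrightarrow> D \<subseteq> D' \<Longrightarrow> D = D'"
    by (elim bexE conjE) (simp add: that)
  let ?B = "{w \<in> S - D. \<exists>d \<in> D. w \<rightarrow>\<^bsub>G\<^esub> d}"
  have no_edge: False if uv: "u \<in> D \<union> ?B" "v \<in> S - (D \<union> ?B)" "u \<rightarrow>\<^bsub>G\<^esub> v" for u v
  proof -
    have far: "\<not> x \<rightarrow>\<^bsub>G\<^esub> v" if "x \<in> D" for x
      using that uv(2) graph_symmetric by blast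
    \<comment> \<open>As \<open>v\<close> is not a neighbour of \<open>D\<close>, the edge leaves
      from some \<open>u\<close> in \<open>B\<close>. Then \<open>u\<close> links \<open>D\<close>
      to \<open>v\<close>, and adding both contradicts maximality.\<close>
    then have "u \<notin> D"
      using uv(3) by blast
    then obtain d where d: "d \<in> D" "d \<rightarrow>\<^bsub>G\<^esub> u" and u: "u \<in> S"
      using uv(1) graph_symmetric by blast
    have "bag G (insert v (insert u D))"
      using D d far uv \<open>u \<notin> D\<close> by (intro bag_extend[of D d u v]) auto
    then have "D = insert v (insert u D)"
      using D u uv(2) by (intro max) auto
    then show False
      using \<open>u \<notin> D\<close> by blast
  qed
  show ?thesis
    using D no_edge by (intro that[of D ?B]) (auto simp: dominates_set_def)
qed

section \<open>Forests of bags\<close>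

text \<open>
  The vertices of the forest are representatives \<open>x \<in> P x\<close> of the bags, and \<open>L x\<close> lists the
  ancestors of \<open>x\<close> from the root down to \<open>x\<close> itself.
\<close>

definition dominating_forest ::
  "('a, 'b) pre_digraph \<Rightarrow> 'a set \<Rightarrow> 'a set \<Rightarrow> ('a \<Rightarrow> 'a list) \<Rightarrow> ('a \<Rightarrow> 'a set) \<Rightarrow> bool" where
  "dominating_forest G S N L P \<longleftrightarrow>
     (\<forall>x \<in> N. x \<in> P x \<and> bag G (P x)) \<and> disjoint_family_on P N \<and> (\<Union>x \<in> N. P x) = S \<and>
     (\<forall>x \<in> N. L x = [x] \<or> (\<exists>y \<in> N. L x = L y @ [x])) \<and>
     (\<forall>x \<in> N. set (L x) \<subseteq> N) \<and>
     (\<forall>x \<in> N. sorted_wrt (dominates_set G) (map P (L x))) \<and>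
     (\<forall>x \<in> N. \<forall>y \<in> N. \<forall>u \<in> P x. \<forall>v \<in> P y. u \<rightarrow>\<^bsub>G\<^esub> v \<longrightarrow> x \<in> set (L y) \<or> y \<in> set (L x))"

lemma dominating_forestD:
  assumes "dominating_forest G S N L P"
  shows "\<And>x. x \<in> N \<Longrightarrow> x \<in> P x"
    and "\<And>x. x \<in> N \<Longrightarrow> bag G (P x)"
    and "disjoint_family_on P N"
    and "(\<Union>x \<in> N. P x) = S"
    and "\<And>x. x \<in> N \<Longrightarrow> L x = [x] \<or> (\<exists>y \<in> N. L x = L y @ [x])"
    and "\<And>x. x \<in> N \<Longrightarrow> set (L x) \<subseteq> N"
    and "\<And>x. x \<in> N \<Longrightarrow> sorted_wrt (dominates_set G) (map P (L x))"
    and "\<And>x y u v. x \<in> N \<Longrightarrow> y \<in> N \<Longrightarrow> u \<in> P x \<Longrightarrow> v \<in> P y \<Longrightarrow> u \<rightarrow>\<^bsub>G\<^esub> v \<Longrightarrow>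
      x \<in> set (L y) \<or> y \<in> set (L x)"
proof -
  have "\<forall>x \<in> N. \<forall>y \<in> N. \<forall>u \<in> P x. \<forall>v \<in> P y. u \<rightarrow>\<^bsub>G\<^esub> v \<longrightarrow> x \<in> set (L y) \<or> y \<in> set (L x)"
    using assms unfolding dominating_forest_def by (elim conjE)
  then show "\<And>x y u v. x \<in> N \<Longrightarrow> y \<in> N \<Longrightarrow> u \<in> P x \<Longrightarrow> v \<in> P y \<Longrightarrow> u \<rightarrow>\<^bsub>G\<^esub> v \<Longrightarrow>
      x \<in> set (L y) \<or> y \<in> set (L x)"
    by blast
qed (use assms in \<open>simp_all add: dominating_forest_def\<close>)

lemma dominating_forest_empty: "dominating_forest G {} {} L P"
  by (simp add: dominating_forest_def disjoint_family_on_def)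

lemma dominating_forest_subset:
  assumes "dominating_forest G S N L P" shows "N \<subseteq> S"
proof
  fix x
  assume "x \<in> N"
  then have "x \<in> (\<Union>y \<in> N. P y)"
    using dominating_forestD(1)[OF assms] by (intro UN_I)
  then show "x \<in> S"
    by (simp only: dominating_forestD(4)[OF assms])
qed

section \<open>Forests under a new root, unions of forests, and existence\<close>

text \<open>Prepending \<open>r\<close> to every root path makes \<open>r\<close> an ancestor of all
  nodes, so every edge meeting \<open>D\<close> joins comparable bags. Since \<open>D\<close>
  dominates \<open>S\<close>, it dominates each old bag and may head every list.\<close>

lemma dominating_forest_add_root:
  assumes F: "dominating_forest G S N L P" and "bag G D" and "r \<in> D" and "D \<inter> S = {}"
    and "dominates_set G D S"
  shows "dominating_forest G (D \<union> S) (insert r N) (\<lambda>x. if x = r then [r] else r # L x) (P(r := D))"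
proof -
  have "r \<notin> N"
    using dominating_forest_subset[OF F] assms(3,4) by blast
  moreover have "P x \<subseteq> S" if "x \<in> N" for x
    using dominating_forestD(4)[OF F] that by blast
  ultimately have P: "(P(r := D)) r = D" "\<And>x. x \<in> N \<Longrightarrow> (P(r := D)) x = P x"
    and PS: "\<And>x. x \<in> N \<Longrightarrow> P x \<subseteq> S" and r: "r \<notin> N"
    by auto
  note bags = dominating_forestD(1,2)[OF F] and disj = dominating_forestD(3)[OF F]
    and cover = dominating_forestD(4)[OF F] and step = dominating_forestD(5)[OF F]
    and paths = dominating_forestD(6)[OF F] and sorted = dominating_forestD(7)[OF F]
    and edges = dominating_forestD(8)[OF F]
  let ?L = "\<lambda>x. if x = r then [r] else r # L x" and ?P = "P(r := D)"
  have U: "(\<Union>x \<in> N. ?P x) = S"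
    using cover P(2) by (simp del: fun_upd_apply)
  have "\<forall>x \<in> insert r N. x \<in> ?P x \<and> bag G (?P x)"
    using bags assms(2,3) by simp
  moreover have "disjoint_family_on ?P (insert r N)"
  proof -
    have "disjoint_family_on ?P N"
      using disj by (simp add: disjoint_family_on_def P(2) del: fun_upd_apply)
    then show ?thesis
      using U assms(4) by (simp add: disjoint_family_on_insert[OF r] P(1) del: fun_upd_apply)
  qed
  moreover have "(\<Union>x \<in> insert r N. ?P x) = D \<union> S"
    using U P(1) by (simp del: fun_upd_apply)
  moreover have "\<forall>x \<in> insert r N. ?L x = [x] \<or> (\<exists>y \<in> insert r N. ?L x = ?L y @ [x])"
  proof
    fix x
    assume x: "x \<in> insert r N"
    \<comment> \<open>The new root, an old root that becomes a child of \<open>r\<close>, and an old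
      node that keeps its parent \<open>y\<close>.\<close>
    consider "x = r" | "x \<in> N" "x \<noteq> r" "L x = [x]" | y where "x \<noteq> r" "y \<in> N" "y \<noteq> r" "L x = L y @ [x]"
      using x step r by blast
    then show "?L x = [x] \<or> (\<exists>y \<in> insert r N. ?L x = ?L y @ [x])"
      by cases auto
  qed
  moreover have "\<forall>x \<in> insert r N. set (?L x) \<subseteq> insert r N"
    using paths by auto
  moreover have "\<forall>x \<in> insert r N. sorted_wrt (dominates_set G) (map ?P (?L x))"
  proof
    fix x
    assume x: "x \<in> insert r N"
    show "sorted_wrt (dominates_set G) (map ?P (?L x))"
    proof (cases "x = r")
      case False
      then have "x \<in> N"
        using x by simp
      have "map ?P (?L x) = D # map P (L x)"
        using False r paths[OF \<open>x \<in> N\<close>] by auto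
      moreover have "dominates_set G D (P y)" if "y \<in> set (L x)" for y
        using assms(5) PS paths[OF \<open>x \<in> N\<close>] that unfolding dominates_set_def by blast
      then have "sorted_wrt (dominates_set G) (D # map P (L x))"
        using sorted[OF \<open>x \<in> N\<close>] by simp
      ultimately show ?thesis
        by (simp only:)
    qed simp
  qed
  moreover have "\<forall>x \<in> insert r N. \<forall>y \<in> insert r N. \<forall>u \<in> ?P x. \<forall>v \<in> ?P y.
      u \<rightarrow>\<^bsub>G\<^esub> v \<longrightarrow> x \<in> set (?L y) \<or> y \<in> set (?L x)"
    using edges by auto
  ultimately show ?thesis
    unfolding dominating_forest_def by (intro conjI)
qed

text \<open>Without edges between \<open>S\<close> and \<open>S'\<close>, the edge condition only
  concerns nodes of the same forest. Representatives lie in their bags, so the node sets are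
  disjoint and the case distinctions pick the right forest.\<close>

lemma (in graph) dominating_forest_Un:
  assumes "dominating_forest G S N L P" and "dominating_forest G S' N' L' P'"
    and "S \<inter> S' = {}" and "\<And>u v. u \<in> S \<Longrightarrow> v \<in> S' \<Longrightarrow> \<not> u \<rightarrow>\<^bsub>G\<^esub> v"
  shows "dominating_forest G (S \<union> S') (N \<union> N')
    (\<lambda>x. if x \<in> N then L x else L' x) (\<lambda>x. if x \<in> N then P x else P' x)"
    (is "dominating_forest G _ _ ?L ?P")
proof -
  have PS: "P x \<subseteq> S" "set (L x) \<subseteq> N" if "x \<in> N" for x
    using dominating_forestD(4,6)[OF assms(1)] that by blast+
  have PS': "P' x \<subseteq> S'" "set (L' x) \<subseteq> N'" if "x \<in> N'" for x
    using dominating_forestD(4,6)[OF assms(2)] that by blast+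
  have "N \<inter> N' = {}"
    using assms(1,2)[THEN dominating_forest_subset] assms(3) by blast
  then have eq: "?L x = L x" "?P x = P x" if "x \<in> N" for x
    using that by auto
  have eq': "?L x = L' x" "?P x = P' x" if "x \<in> N'" for x
    using that \<open>N \<inter> N' = {}\<close> by auto
  have no_edge: "\<not> u \<rightarrow>\<^bsub>G\<^esub> v" "\<not> v \<rightarrow>\<^bsub>G\<^esub> u" if "x \<in> N" "y \<in> N'" "u \<in> ?P x" "v \<in> ?P y" for x y u v
  proof -
    have "u \<in> S" "v \<in> S'"
      using that PS(1)[OF that(1)] PS'(1)[OF that(2)] eq'(2)[OF that(2)] by auto
    then show "\<not> u \<rightarrow>\<^bsub>G\<^esub> v" "\<not> v \<rightarrow>\<^bsub>G\<^esub> u"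
      using assms(4) graph_symmetric by blast+
  qed
  have sorted: "sorted_wrt (dominates_set G) (map ?P (?L x))" if "x \<in> N" for x
  proof -
    have "map ?P (?L x) = map P (L x)"
      using PS(2)[OF that] that by auto
    then show ?thesis
      using dominating_forestD(7)[OF assms(1) that] by simp
  qed
  have sorted': "sorted_wrt (dominates_set G) (map ?P (?L x))" if "x \<in> N'" for x
  proof -
    have "map ?P (?L x) = map P' (L' x)"
      unfolding eq'(1)[OF that] using PS'(2)[OF that] eq'(2) by (intro map_cong refl) blast
    then show ?thesis
      using dominating_forestD(7)[OF assms(2) that] by simp
  qed
  have "\<forall>x \<in> N \<union> N'. x \<in> ?P x \<and> bag G (?P x)"
    using dominating_forestD(1,2)[OF assms(1)] dominating_forestD(1,2)[OF assms(2)] by auto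
  moreover have "disjoint_family_on ?P (N \<union> N')"
  proof (unfold disjoint_family_on_def, intro ballI impI)
    fix x y
    assume "x \<in> N \<union> N'" "y \<in> N \<union> N'" "x \<noteq> y"
    then consider "x \<in> N" "y \<in> N" | "x \<in> N'" "y \<in> N'" | "x \<in> N" "y \<in> N'" | "x \<in> N'" "y \<in> N"
      by blast
    then show "?P x \<inter> ?P y = {}"
    proof cases
      case 1
      then show ?thesis
        using dominating_forestD(3)[OF assms(1)] \<open>x \<noteq> y\<close> by (simp add: disjoint_family_on_def)
    next
      case 2
      then show ?thesis
        using dominating_forestD(3)[OF assms(2)] \<open>x \<noteq> y\<close> eq'(2)[OF 2(1)] eq'(2)[OF 2(2)]
        by (simp add: disjoint_family_on_def)
    next
      case 3
      then show ?thesis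
        unfolding eq(2)[OF 3(1)] eq'(2)[OF 3(2)]
        using assms(3) PS(1)[OF 3(1)] PS'(1)[OF 3(2)] by blast
    next
      case 4
      then show ?thesis
        unfolding eq(2)[OF 4(2)] eq'(2)[OF 4(1)]
        using assms(3) PS(1)[OF 4(2)] PS'(1)[OF 4(1)] by blast
    qed
  qed
  moreover have "(\<Union>x \<in> N \<union> N'. ?P x) = S \<union> S'"
  proof -
    have "(\<Union>x \<in> N. ?P x) = (\<Union>x \<in> N. P x)" "(\<Union>x \<in> N'. ?P x) = (\<Union>x \<in> N'. P' x)"
      using eq(2) eq'(2) by (intro SUP_cong refl; blast)+
    then have "(\<Union>x \<in> N. ?P x) = S" "(\<Union>x \<in> N'. ?P x) = S'"
      using dominating_forestD(4)[OF assms(1)] dominating_forestD(4)[OF assms(2)] by (simp_all only:)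
    then show ?thesis
      by blast
  qed
  moreover have "\<forall>x \<in> N \<union> N'. ?L x = [x] \<or> (\<exists>y \<in> N \<union> N'. ?L x = ?L y @ [x])"
  proof
    fix x
    assume "x \<in> N \<union> N'"
    then show "?L x = [x] \<or> (\<exists>y \<in> N \<union> N'. ?L x = ?L y @ [x])"
    proof
      assume "x \<in> N"
      then have "L x = [x] \<or> (\<exists>y \<in> N. L x = L y @ [x])"
        by (rule dominating_forestD(5)[OF assms(1)])
      then show ?thesis
        using \<open>x \<in> N\<close> by auto
    next
      assume "x \<in> N'"
      then have "L' x = [x] \<or> (\<exists>y \<in> N'. L' x = L' y @ [x])"
        by (rule dominating_forestD(5)[OF assms(2)])
      then show ?thesis
        using eq'(1) \<open>x \<in> N'\<close> by (metis UnI2)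
    qed
  qed
  moreover have "\<forall>x \<in> N \<union> N'. set (?L x) \<subseteq> N \<union> N'"
    using PS(2) PS'(2) by auto
  moreover have "\<forall>x \<in> N \<union> N'. sorted_wrt (dominates_set G) (map ?P (?L x))"
    using sorted sorted' by blast
  moreover have "\<forall>x \<in> N \<union> N'. \<forall>y \<in> N \<union> N'. \<forall>u \<in> ?P x. \<forall>v \<in> ?P y.
      u \<rightarrow>\<^bsub>G\<^esub> v \<longrightarrow> x \<in> set (?L y) \<or> y \<in> set (?L x)"
  proof (intro ballI impI)
    fix x y u v
    assume "x \<in> N \<union> N'" "y \<in> N \<union> N'" and uv: "u \<in> ?P x" "v \<in> ?P y" "u \<rightarrow>\<^bsub>G\<^esub> v"
    then consider "x \<in> N" "y \<in> N" | "x \<in> N'" "y \<in> N'"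
      using no_edge by blast
    then show "x \<in> set (?L y) \<or> y \<in> set (?L x)"
    proof cases
      case 1
      then show ?thesis
        using dominating_forestD(8)[OF assms(1)] uv by simp
    next
      case 2
      then show ?thesis
        using dominating_forestD(8)[OF assms(2) 2] uv
        unfolding eq'[OF 2(1)] eq'[OF 2(2)] by blast
    qed
  qed
  ultimately show ?thesis
    unfolding dominating_forest_def by (intro conjI)
qed

text \<open>Strong induction on \<open>S\<close>. A forest on \<open>B\<close> is hung below the bag
  \<open>D\<close>, and a forest on the remaining vertices of \<open>S\<close> is placed beside
  it.\<close>

lemma (in graph) dominating_forest_exists:
  assumes "S \<subseteq> verts G"
  shows "\<exists>N L P. dominating_forest G S N L P"
proof -
  have "finite S"
    using assms finite_verts finite_subset by blast
  then show ?thesis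
    using assms
  proof (induction S rule: finite_psubset_induct)
    case (psubset S)
    show ?case
    proof (cases "S = {}")
      case True
      then show ?thesis
        using dominating_forest_empty by blast
    next
      case False
      then obtain r where "r \<in> S"
        by blast
      then obtain D B where D: "bag G D" "r \<in> D" "D \<inter> B = {}" "D \<union> B \<subseteq> S" "dominates_set G D B"
        and no_edge: "\<And>u v. u \<in> D \<union> B \<Longrightarrow> v \<in> S - (D \<union> B) \<Longrightarrow> \<not> u \<rightarrow>\<^bsub>G\<^esub> v"
        using dominating_bag_exists[OF psubset.prems] by metis
      \<comment> \<open>Both sets miss \<open>r\<close>, which lies in \<open>D\<close>.\<close>
      have "B \<subset> S" "S - (D \<union> B) \<subset> S"
        using D \<open>r \<in> S\<close> by blast+
      then obtain N L P N' L' P' where FB: "dominating_forest G B N L P"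
        and F': "dominating_forest G (S - (D \<union> B)) N' L' P'"
        using psubset.IH psubset.prems by (metis psubset_imp_subset subset_trans)
      have "\<exists>N L P. dominating_forest G (D \<union> B) N L P"
        using dominating_forest_add_root[OF FB D(1,2,3,5)] by blast
      then obtain N L P where F: "dominating_forest G (D \<union> B) N L P"
        by blast
      have "(D \<union> B) \<union> (S - (D \<union> B)) = S"
        using D by blast
      then show ?thesis
        using dominating_forest_Un[OF F F' _ no_edge] by auto
    qed
  qed
qed

section \<open>Trees given by their root paths\<close>

text \<open>Each path is one entry longer than that of the parent, so passing to parents must stop,
  and it can only stop at \<open>r\<close>. This makes the structure a single tree.\<close>

locale root_paths =
  fixes N :: "'a set" and r :: 'a and L :: "'a \<Rightarrow> 'a list"
  assumes finite_nodes: "finite N" and root_in_nodes: "r \<in> N" and path_root: "L r = [r]"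
    and path_step: "x \<in> N \<Longrightarrow> x \<noteq> r \<Longrightarrow> \<exists>y \<in> N. L x = L y @ [x]"
begin

definition path_tree :: "'a pair_pre_digraph" where
  "path_tree = \<lparr>pverts = N, parcs = {(x, y) \<in> N \<times> N. L y = L x @ [y] \<or> L x = L y @ [x]}\<rparr>"

abbreviation "T \<equiv> with_proj path_tree"

lemma pverts_path_tree [simp]: "pverts path_tree = N"
  and parcs_path_tree:
    "parcs path_tree = {(x, y) \<in> N \<times> N. L y = L x @ [y] \<or> L x = L y @ [x]}"
  by (simp_all add: path_tree_def)

lemma last_path:
  assumes "x \<in> N" shows "L x \<noteq> []" and "last (L x) = x"
  using path_root path_step[OF assms] by (cases "x = r"; force)+

lemma graph_path_tree: "graph T"
proof
  show "finite (arcs T)"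
    using finite_nodes by (auto simp: parcs_path_tree intro: finite_subset[of _ "N \<times> N"])
  show "symmetric T"
    by (auto simp: symmetric_def sym_def parcs_path_tree)
qed (use finite_nodes in \<open>auto simp: parcs_path_tree arc_to_ends_def\<close>)

sublocale T: graph T
  by (rule graph_path_tree)

section \<open>Root paths, ancestors and acyclicity of the tree\<close>

lemma reachable_from_root: "x \<in> N \<Longrightarrow> r \<rightarrow>\<^sup>*\<^bsub>T\<^esub> x"
proof (induction "length (L x)" arbitrary: x rule: less_induct)
  case less
  show ?case
  proof (cases "x = r")
    case True
    then show ?thesis
      using root_in_nodes by simp
  next
    case False
    then obtain y where y: "y \<in> N" "L x = L y @ [x]"
      using path_step less.prems by blast
    then have "r \<rightarrow>\<^sup>*\<^bsub>T\<^esub> y"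
      by (intro less.hyps) auto
    moreover have "y \<rightarrow>\<^bsub>T\<^esub> x"
      using y less.prems by (simp add: parcs_path_tree)
    ultimately show ?thesis
      by (rule T.reachable_adj_trans)
  qed
qed

lemma connected_path_tree: "Digraph_Component.connected T"
  using reachable_from_root root_in_nodes by (auto simp: T.connected_iff_reachable_from)

text \<open>A walk from the root without repeated vertices never steps up: the parent of the current
  vertex ends the preceding part of its root path, hence was already visited. So each arc leads to a
  child and appends it to the list.\<close>

lemma awalk_verts_eq_path:
  assumes "T.apath r p y" shows "T.awalk_verts r p = L y"
  using assms
proof (induction p arbitrary: y rule: rev_induct)
  case Nil
  then show ?case
    using path_root by (simp add: T.apath_Nil_iff)
next
  case (snoc e p)
  have p: "T.apath r p (fst e)"
    and e: "e \<in> parcs path_tree" "snd e = y" "y \<notin> set (T.awalk_verts r p)"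
    using snoc.prems by (auto simp: T.apath_append_iff T.apath_simps)
  have verts: "T.awalk_verts r p = L (fst e)"
    by (rule snoc.IH[OF p])
  have "L (fst e) \<noteq> L y @ [fst e]"
  proof
    assume *: "L (fst e) = L y @ [fst e]"
    have "L y \<noteq> []" "last (L y) = y"
      using last_path[of y] e by (auto simp: parcs_path_tree)
    then have "y \<in> set (L (fst e))"
      using * by (metis UnI1 last_in_set set_append)
    then show False
      using e verts by simp
  qed
  then have "L y = L (fst e) @ [y]"
    using e by (auto simp: parcs_path_tree)
  moreover have "T.awalk_verts r (p @ [e]) = T.awalk_verts r p @ [y]"
    using snoc.prems e T.apath_def T.awalk_verts_append by auto
  ultimately show ?case
    using verts by simp
qed

text \<open>Some path from \<open>r\<close> to \<open>y\<close> exists by reachability, and every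
  such path visits exactly the entries of \<open>L y\<close>.\<close>

lemma ancestor_path_tree:
  assumes "y \<in> N" shows "ancestor T r x y \<longleftrightarrow> x \<in> set (L y)"
  using reachable_from_root[OF assms] awalk_verts_eq_path
  unfolding ancestor_def T.reachable_apath by metis

text \<open>Both neighbours on a cycle of a vertex with a longest root path would be its parent.\<close>

lemma no_long_cycle: "\<not> (\<exists>p. T.cycle p \<and> length p \<ge> 3)"
proof
  assume "\<exists>p. T.cycle p \<and> length p \<ge> 3"
  then obtain u p where p: "T.awalk u p u" "distinct (tl (T.awalk_verts u p))" "length p \<ge> 3"
    unfolding T.cycle_def by blast
  let ?n = "length p"
  have "p \<noteq> []" "T.cas u p u" "set p \<subseteq> parcs path_tree"
    using p(1,3) by (auto simp: T.awalk_def)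
  then have verts: "T.awalk_verts u p = u # map snd p"
    using T.awalk_verts_conv'[of u p u] by (cases p) auto
  then have distinct: "distinct (map snd p)"
    using p(2) by simp
  \<comment> \<open>The vertices of the closed walk are listed once by heads and once by tails;
    comparing the lists makes each head the next tail.\<close>
  have shift: "u # map snd p = map fst p @ [u]"
  proof -
    have "T.awalk_verts u p = map fst p @ [snd (last p)]"
      using \<open>p \<noteq> []\<close> by (simp add: T.awalk_verts_conv)
    moreover have "snd (last p) = u"
      using T.awlast_of_awalk[OF p(1)] calculation by simp
    ultimately show ?thesis
      using verts by simp
  qed
  have next_arc: "fst (p ! (Suc i mod ?n)) = snd (p ! i)" if "i < ?n" for i
  proof -
    have snd: "snd (p ! i) = (map fst p @ [u]) ! Suc i"
      using that by (simp flip: shift)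
    have "fst (p ! 0) = u"
      using arg_cong[OF shift, of hd] \<open>p \<noteq> []\<close> by (simp add: hd_append hd_map hd_conv_nth)
    moreover have "Suc i = ?n" if "\<not> Suc i < ?n"
      using \<open>i < ?n\<close> that by simp
    ultimately show ?thesis
      by (cases "Suc i < ?n") (simp_all add: snd nth_append)
  qed
  let ?h = "\<lambda>e. length (L (snd e))"
  have "Max (?h ` set p) \<in> ?h ` set p"
    using \<open>p \<noteq> []\<close> by (intro Max_in) auto
  then obtain i where i: "i < ?n" "?h (p ! i) = Max (?h ` set p)"
    by (auto simp: in_set_conv_nth)
  have max: "?h (p ! j) \<le> ?h (p ! i)" if "j < ?n" for j
    using that i(2) by simp
  \<comment> \<open>The cyclic successor and predecessor of \<open>i\<close>; adding
    \<open>?n\<close> before subtracting avoids truncation at \<open>i = 0\<close>. They differ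
    because the cycle has length at least 3.\<close>
  define j where "j = Suc i mod ?n"
  define k where "k = (i + ?n - 1) mod ?n"
  have jk: "j < ?n" "k < ?n" "Suc k mod ?n = i" "j \<noteq> k"
  proof -
    show "j < ?n" "k < ?n"
      using \<open>p \<noteq> []\<close> by (simp_all add: j_def k_def)
    have k: "k = (if i = 0 then ?n - 1 else i - 1)"
      using i(1) p(3) by (auto simp: k_def mod_if)
    then show "Suc k mod ?n = i"
      using i(1) p(3) by auto
    show "j \<noteq> k"
      using k i(1) p(3) by (auto simp: j_def mod_if split: if_splits)
  qed
  \<comment> \<open>Adjacent nodes have root paths of different lengths, so the end whose path is
    not longer is the parent.\<close>
  have parent: "y \<in> N \<and> L x = L y @ [x]"
    if "(x, y) \<in> parcs path_tree \<or> (y, x) \<in> parcs path_tree" "length (L y) \<le> length (L x)" for x y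
    using that by (auto simp: parcs_path_tree)
  have "(snd (p ! i), snd (p ! j)) \<in> parcs path_tree"
    using next_arc[OF i(1)] jk(1) \<open>set p \<subseteq> _\<close> by (metis j_def nth_mem prod.collapse subsetD)
  then have b: "snd (p ! j) \<in> N \<and> L (snd (p ! i)) = L (snd (p ! j)) @ [snd (p ! i)]"
    using parent max jk(1) by blast
  have "(snd (p ! k), snd (p ! i)) \<in> parcs path_tree"
    using next_arc[OF jk(2)] jk(3) i(1) \<open>set p \<subseteq> _\<close> by (metis nth_mem prod.collapse subsetD)
  then have c: "snd (p ! k) \<in> N \<and> L (snd (p ! i)) = L (snd (p ! k)) @ [snd (p ! i)]"
    using parent max jk(2) by blast
  have "L (snd (p ! j)) = L (snd (p ! k))"
    using b c by simp
  \<comment> \<open>A node is the last entry of its root path, so equal paths mean equal nodes,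
    against the distinctness of the heads.\<close>
  then have "snd (p ! j) = snd (p ! k)"
    using b c last_path(2) by metis
  then show False
    using distinct jk by (simp add: distinct_conv_nth)
qed

lemma rooted_tree_path_tree: "rooted_tree T r"
  using graph_path_tree connected_path_tree no_long_cycle root_in_nodes
  by (simp add: rooted_tree_def undirected_tree_def)

end

section \<open>Assembly of the tree and the partition\<close>

theorem theorem13:
  fixes G :: "('a, 'b) pre_digraph"
  assumes "graph G"
    and "verts G \<noteq> {}"
    and "Digraph_Component.connected G"
  shows "\<exists>(T :: 'a pair_pre_digraph) r (PP :: 'a set set) (P :: 'a \<Rightarrow> 'a set).
      rooted_tree (with_proj T) r \<and>
      partition_on (verts G) PP \<and>
      bij_betw P (pverts T) PP \<and>
      (\<forall>x \<in> pverts T. Digraph_Component.connected (G \<restriction> P x)) \<and>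
      (\<forall>x \<in> pverts T. \<forall>y \<in> pverts T. x \<noteq> y \<longrightarrow>
         ((\<exists>u \<in> P x. \<exists>v \<in> P y. u \<rightarrow>\<^bsub>G\<^esub> v) \<longleftrightarrow>
          ancestor (with_proj T) r x y \<or> ancestor (with_proj T) r y x)) \<and>
      (\<forall>x \<in> pverts T. \<exists>I. independent_set G I \<and> I \<subseteq> P x \<and>
         int (card (P x)) = 2 * int (card I) - 1) \<and>
      (\<forall>v p. leaf (with_proj T) r v \<and> pre_digraph.apath (with_proj T) r p v \<longrightarrow>
         (let xs = pre_digraph.awalk_verts (with_proj T) r p
          in dominating_K_model G (length xs) (map (\<lambda>x. G \<restriction> P x) xs)))"
proof -
  interpret G: graph G
    by (rule assms(1))
  obtain r where r: "r \<in> verts G" "\<And>v. v \<in> verts G \<Longrightarrow> r \<rightarrow>\<^sup>*\<^bsub>G\<^esub> v"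
    using assms(3) by (auto simp: G.connected_iff_reachable_from)
  \<comment> \<open>The first bag is taken in the whole graph. No edge leaves
    \<open>D \<union> B\<close>, so connectivity turns this union into the full vertex set, and the
    forest has the single root \<open>r\<close>.\<close>
  obtain D B where D: "bag G D" "r \<in> D" "D \<inter> B = {}" "D \<union> B \<subseteq> verts G" "dominates_set G D B"
    and no_edge: "\<And>u v. u \<in> D \<union> B \<Longrightarrow> v \<in> verts G - (D \<union> B) \<Longrightarrow> \<not> u \<rightarrow>\<^bsub>G\<^esub> v"
    using G.dominating_bag_exists[OF subset_refl r(1)] by metis
  have "v \<in> D \<union> B" if "v \<in> verts G" for v
    using r(2)[OF that]
  proof (induction rule: G.reachable_induct)
    case base
    then show ?case
      using D(2) by blast
  next
    case (step x y)
    then show ?case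
      using no_edge G.adj_in_verts(2) by blast
  qed
  then have verts: "D \<union> B = verts G"
    using D(4) by blast
  obtain N0 L0 P0 where F0: "dominating_forest G B N0 L0 P0"
    using G.dominating_forest_exists[of B] D(4) by blast
  define N where "N = insert r N0"
  define L where "L = (\<lambda>x. if x = r then [r] else r # L0 x)"
  define P where "P = P0(r := D)"
  have F: "dominating_forest G (verts G) N L P"
    using dominating_forest_add_root[OF F0 D(1,2,3,5)] by (simp add: N_def L_def P_def verts)
  have N: "N \<subseteq> verts G"
    by (rule dominating_forest_subset[OF F])
  have bags: "x \<in> P x" "bag G (P x)" if "x \<in> N" for x
    using dominating_forestD(1,2)[OF F that] .
  have disj: "P x \<inter> P y = {}" if "x \<in> N" "y \<in> N" "x \<noteq> y" for x y
    using dominating_forestD(3)[OF F] that unfolding disjoint_family_on_def by blast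
  have paths: "set (L x) \<subseteq> N" "sorted_wrt (dominates_set G) (map P (L x))"
    if "x \<in> N" for x
    using dominating_forestD(6,7)[OF F that] .
  have edges: "x \<in> set (L y) \<or> y \<in> set (L x)"
    if "x \<in> N" "y \<in> N" "u \<in> P x" "v \<in> P y" "u \<rightarrow>\<^bsub>G\<^esub> v" for x y u v
    using dominating_forestD(8)[OF F that] .
  interpret root_paths N r L
  proof
    show "finite N"
      using N G.finite_verts finite_subset by blast
    show "\<exists>y \<in> N. L x = L y @ [x]" if "x \<in> N" "x \<noteq> r" for x
    proof -
      have "L x = [x] \<or> (\<exists>y \<in> N. L x = L y @ [x])"
        by (rule dominating_forestD(5)[OF F that(1)])
      \<comment> \<open>The list \<open>L x\<close> begins with \<open>r\<close>, which differs from
        \<open>x\<close>; this excludes a second root.\<close>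
      moreover have "L x \<noteq> [x]"
        using that(2) by (simp add: L_def)
      ultimately show ?thesis
        by blast
    qed
  qed (simp_all add: N_def L_def)
  \<comment> \<open>\<open>y\<close> is the last entry of \<open>L y\<close>, so sortedness makes
    the bag of each earlier entry dominate \<open>P y\<close>. As \<open>P y\<close> is non-empty,
    an edge results.\<close>
  have path_edge: "\<exists>v \<in> P y. \<exists>u \<in> P x. v \<rightarrow>\<^bsub>G\<^esub> u" if y: "y \<in> N" "x \<in> set (L y)" "x \<noteq> y" for x y
  proof -
    obtain ys where ys: "L y = ys @ [y]"
      using last_path[OF y(1)] append_butlast_last_id by metis
    then have "dominates_set G (P x) (P y)"
      using paths(2)[OF y(1)] y(2,3) by (auto simp: sorted_wrt_append)
    then show ?thesis
      using bags(1)[OF y(1)] unfolding dominates_set_def by blast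
  qed
  have "partition_on (verts G) (P ` N)"
  proof (rule partition_onI)
    show "\<Union> (P ` N) = verts G"
      by (rule dominating_forestD(4)[OF F])
    show "disjnt p q" if "p \<in> P ` N" "q \<in> P ` N" "p \<noteq> q" for p q
      using that disj unfolding disjnt_def by blast
    show "{} \<notin> P ` N"
      using bags(1) by blast
  qed
  moreover have "bij_betw P N (P ` N)"
    using bags(1) disj unfolding bij_betw_def inj_on_def by blast
  moreover have "\<exists>I. independent_set G I \<and> I \<subseteq> P x \<and> int (card (P x)) = 2 * int (card I) - 1"
    if x: "x \<in> N" for x
  proof -
    obtain I where "independent_set G I" "I \<subseteq> P x" "card (P x) + 1 = 2 * card I"
      using bags(2)[OF x] unfolding bag_def by blast
    then show ?thesis
      by (intro exI[of _ I]) simp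
  qed
  moreover have "(\<exists>u \<in> P x. \<exists>v \<in> P y. u \<rightarrow>\<^bsub>G\<^esub> v) \<longleftrightarrow> ancestor T r x y \<or> ancestor T r y x"
    if "x \<in> N" "y \<in> N" "x \<noteq> y" for x y
    using that edges path_edge G.graph_symmetric by (simp add: ancestor_path_tree) blast
  moreover have "dominating_K_model G (length (T.awalk_verts r p))
      (map (\<lambda>x. G \<restriction> P x) (T.awalk_verts r p))" if "T.apath r p v" for p v
  proof -
    have v: "v \<in> N"
      using T.awalk_last_in_verts[OF T.awalkI_apath[OF that]] by simp
    have L: "T.awalk_verts r p = L v"
      by (rule awalk_verts_eq_path[OF that])
    \<comment> \<open>Distinct positions on the path thus carry distinct nodes, whose bags are
      disjoint.\<close>
    then have distinct: "distinct (L v)"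
      using that by (simp add: T.apath_def)
    have nodes: "L v ! i \<in> N" if "i < length (L v)" for i
      using paths(1)[OF v] that nth_mem by blast
    have "graph (G \<restriction> P x)" "subgraph (G \<restriction> P x) G" "P x \<noteq> {}"
      "Digraph_Component.connected (G \<restriction> P x)" if "x \<in> N" for x
      using bags[OF that] G.graph_induce G.subgraph_induce_subgraphI unfolding bag_def by blast+
    moreover have "P (L v ! i) \<inter> P (L v ! j) = {}" if "i < j" "j < length (L v)" for i j
      using that nodes distinct by (intro disj) (auto simp: nth_eq_iff_index_eq)
    moreover have "dominates_set G (P (L v ! i)) (P (L v ! j))" if "i < j" "j < length (L v)" for i j
      using sorted_wrt_nth_less[OF paths(2)[OF v] \<open>i < j\<close>] \<open>i < j\<close> \<open>j < _\<close> by simp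
    ultimately show ?thesis
      using nodes unfolding L dominating_K_model_def dominates_set_def by simp blast
  qed
  ultimately show ?thesis
    using rooted_tree_path_tree bags(2) unfolding bag_def Let_def
    by (intro exI[of _ path_tree] exI[of _ r] exI[of _ "P ` N"] exI[of _ P]) (simp, blast)
qed

end
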